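(* Let $(X_n,\Phi_n)$ and $(Y_n,\Psi_n)$ be two $D_-$-chains. Then there is a common zig-zag $D_-$-chain of $(X_n,\Phi_n)$ and $(Y_n,\Psi_n)$ if and only if $end(X_n,\Phi_n)$ and $end(Y_n,\Psi_n)$ are uniformly homeomorphic.
   Context: $\mathbb N=\{1,2,\dots\}$. Two metric spaces are uniformly homeomorphic if there is a bijection between them that is uniformly continuous with uniformly continuous inverse. $D_-$-chain: a sequence of sets $X_n$ ($n\in\mathbb N$) and surjective maps $\Phi_n\colon X_{n+1}\to X_n$. End space: $end(X_n,\Phi_n)=\{(x_n)_{n\in\mathbb N}:x_n\in X_n,\ \Phi_n(x_{n+1})=x_n\}$ with the ultrametric given, for distinct sequences, by $D((x_n),(y_n))=2^{-n_0}$ where $n_0=\max\{n:x_n=y_n\}$ if some $x_n=y_n$, and $D((x_n),(y_n))=1$ if $x_n\ne y_n$ for all $n$; $D=0$ for equal sequences. Subchain: for a (strictly) increasing $\alpha\colon\mathbb N\to\mathbb N$, the $\alpha$-subchain is $(X_{\alpha(n)},\tilde\Phi_n)$ with $\tilde\Phi_n=\Phi_{\alpha(n)}\circ\cdots\circ\Phi_{\alpha(n+1)-1}\colon X_{\alpha(n+1)}\to X_{\alpha(n)}$. Common zig-zag $D_-$-chain: a $D_-$-chain $(Z_n,\mathcal V_n)$ is a common zig-zag $D_-$-chain of $(X_n,\Phi_n)$ and $(Y_n,\Psi_n)$ if there are increasing $\alpha,\beta\colon\mathbb N\to\mathbb N$ such that $Z_{2n-1}=X_{\alpha(n)}$, $Z_{2n}=Y_{\beta(n)}$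 for all $n\ge1$ (so $\mathcal V_{2n-1}\colon Y_{\beta(n)}\to X_{\alpha(n)}$ and $\mathcal V_{2n}\colon X_{\alpha(n+1)}\to Y_{\beta(n)}$), and $\mathcal V_{2n-1}\circ\mathcal V_{2n}=\tilde\Phi_n$, $\mathcal V_{2n}\circ\mathcal V_{2n+1}=\tilde\Psi_n$ for all $n$, where $(X_{\alpha(n)},\tilde\Phi_n)$ and $(Y_{\beta(n)},\tilde\Psi_n)$ are the corresponding subchains. *)

theory Defs
  imports "HOL-Analysis.Analysis"
begin

text \<open>
  Natural numbers start at 1 here: all sequences are indexed by the positive elements of
  \<^typ>\<open>nat\<close>, and their values at index 0 are irrelevant. The sets of a chain live in
  a common ambient type, and a map between two of them is a total function on that type
  of which only the values on its domain set matter.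
\<close>

definition D_chain :: "(nat \<Rightarrow> 'a set) \<Rightarrow> (nat \<Rightarrow> 'a \<Rightarrow> 'a) \<Rightarrow> bool" where
  "D_chain X \<Phi> \<longleftrightarrow> (\<forall>n\<ge>1. \<Phi> n ` X (n + 1) = X n)"

text \<open>
  Extensionality (\<open>PiE\<close>) removes the index 0, so that equality of elements of
  the end space is equality of sequences indexed from 1.
\<close>

definition end_set :: "(nat \<Rightarrow> 'a set) \<Rightarrow> (nat \<Rightarrow> 'a \<Rightarrow> 'a) \<Rightarrow> (nat \<Rightarrow> 'a) set" where
  "end_set X \<Phi> = {x \<in> PiE {1..} X. \<forall>n\<ge>1. \<Phi> n (x (n + 1)) = x n}"

text \<open>
  On distinct elements of an end space the set whose maximum is taken is finite
  (lemma \<open>finite_agree\<close> below).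
\<close>

definition end_dist :: "(nat \<Rightarrow> 'a) \<Rightarrow> (nat \<Rightarrow> 'a) \<Rightarrow> real" where
  "end_dist x y =
     (if x = y then 0
      else if \<exists>n\<ge>1. x n = y n then 1 / 2 ^ Max {n. n \<ge> 1 \<and> x n = y n}
      else 1)"

definition end_space :: "(nat \<Rightarrow> 'a set) \<Rightarrow> (nat \<Rightarrow> 'a \<Rightarrow> 'a) \<Rightarrow> (nat \<Rightarrow> 'a) metric" where
  "end_space X \<Phi> = metric (end_set X \<Phi>, end_dist)"

definition uniformly_homeomorphic :: "'a metric \<Rightarrow> 'b metric \<Rightarrow> bool" where
  "uniformly_homeomorphic m1 m2 \<longleftrightarrow>
     (\<exists>f. bij_betw f (mspace m1) (mspace m2) \<and>
          uniformly_continuous_map m1 m2 f \<and>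
          uniformly_continuous_map m2 m1 (inv_into (mspace m1) f))"

definition increasing_seq :: "(nat \<Rightarrow> nat) \<Rightarrow> bool" where
  "increasing_seq \<alpha> \<longleftrightarrow> \<alpha> ` {1..} \<subseteq> {1..} \<and> strict_mono_on {1..} \<alpha>"

text \<open>\<open>bond \<Phi> m d\<close> is the composition of the \<open>d\<close> maps \<open>\<Phi> m, \<dots>, \<Phi> (m + d - 1)\<close>.\<close>

primrec bond :: "(nat \<Rightarrow> 'a \<Rightarrow> 'a) \<Rightarrow> nat \<Rightarrow> nat \<Rightarrow> 'a \<Rightarrow> 'a" where
  "bond \<Phi> m 0 = id"
| "bond \<Phi> m (Suc d) = bond \<Phi> m d \<circ> \<Phi> (m + d)"

definition subchain_set :: "(nat \<Rightarrow> 'a set) \<Rightarrow> (nat \<Rightarrow> nat) \<Rightarrow> nat \<Rightarrow> 'a set" where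
  "subchain_set X \<alpha> n = X (\<alpha> n)"

definition subchain_map :: "(nat \<Rightarrow> 'a \<Rightarrow> 'a) \<Rightarrow> (nat \<Rightarrow> nat) \<Rightarrow> nat \<Rightarrow> 'a \<Rightarrow> 'a" where
  "subchain_map \<Phi> \<alpha> n = bond \<Phi> (\<alpha> n) (\<alpha> (n + 1) - \<alpha> n)"

definition common_zigzag ::
  "(nat \<Rightarrow> 'a set) \<Rightarrow> (nat \<Rightarrow> 'a \<Rightarrow> 'a) \<Rightarrow> (nat \<Rightarrow> 'a set) \<Rightarrow> (nat \<Rightarrow> 'a \<Rightarrow> 'a) \<Rightarrow>
   (nat \<Rightarrow> 'a set) \<Rightarrow> (nat \<Rightarrow> 'a \<Rightarrow> 'a) \<Rightarrow> bool" where
  "common_zigzag Z V X \<Phi> Y \<Psi> \<longleftrightarrow>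
     D_chain Z V \<and>
     (\<exists>\<alpha> \<beta>. increasing_seq \<alpha> \<and> increasing_seq \<beta> \<and>
        (\<forall>n\<ge>1. Z (2 * n - 1) = subchain_set X \<alpha> n \<and> Z (2 * n) = subchain_set Y \<beta> n) \<and>
        (\<forall>n\<ge>1. \<forall>x \<in> subchain_set X \<alpha> (n + 1).
            V (2 * n - 1) (V (2 * n) x) = subchain_map \<Phi> \<alpha> n x) \<and>
        (\<forall>n\<ge>1. \<forall>y \<in> subchain_set Y \<beta> (n + 1).
            V (2 * n) (V (2 * n + 1) y) = subchain_map \<Psi> \<beta> n y))"

lemma end_set_agree_below:
  assumes x: "x \<in> end_set X \<Phi>" and y: "y \<in> end_set X \<Phi>"
    and eq: "x n = y n" and m: "1 \<le> m" "m \<le> n"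
  shows "x m = y m"
  using m(2) m(1) eq
proof (induction rule: inc_induct)
  case base
  then show ?case by simp
next
  case (step k)
  have "x (k + 1) = y (k + 1)" using step by simp
  moreover have "\<Phi> k (x (k + 1)) = x k" "\<Phi> k (y (k + 1)) = y k"
    using x y step.prems(1) by (auto simp: end_set_def)
  ultimately show ?case by metis
qed

lemma finite_agree:
  assumes x: "x \<in> end_set X \<Phi>" and y: "y \<in> end_set X \<Phi>" and "x \<noteq> y"
  shows "finite {n. n \<ge> 1 \<and> x n = y n}"
proof -
  have "\<exists>k\<ge>1. x k \<noteq> y k"
  proof (rule ccontr)
    assume "\<not> ?thesis"
    then have "x = y"
      using PiE_ext[where k = "{1..}" and s = X and x = x and y = y] x y
      by (simp add: end_set_def)
    with \<open>x \<noteq> y\<close> show False by simp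
  qed
  then obtain k where "k \<ge> 1" "x k \<noteq> y k" by blast
  have "{n. n \<ge> 1 \<and> x n = y n} \<subseteq> {..<k}"
  proof
    fix n assume "n \<in> {n. n \<ge> 1 \<and> x n = y n}"
    then have "\<not> k \<le> n"
      using end_set_agree_below[OF x y, where n = n and m = k] \<open>k \<ge> 1\<close> \<open>x k \<noteq> y k\<close> by blast
    then show "n \<in> {..<k}" by simp
  qed
  then show ?thesis using finite_subset by blast
qed

lemma end_dist_cases:
  assumes "x \<in> end_set X \<Phi>" "y \<in> end_set X \<Phi>"
  obtains "x = y"
    | "x \<noteq> y" "end_dist x y = 1"
    | n where "x \<noteq> y" "n \<ge> 1" "x n = y n" "end_dist x y = 1 / 2 ^ n"
proof (cases "x \<noteq> y \<and> (\<exists>n\<ge>1. x n = y n)")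
  case True
  let ?A = "{n. n \<ge> 1 \<and> x n = y n}"
  have "Max ?A \<in> ?A"
    using True finite_agree[OF assms] by (intro Max_in) auto
  moreover have "end_dist x y = 1 / 2 ^ Max ?A"
    using True by (simp add: end_dist_def)
  ultimately show ?thesis using that(3) True by blast
next
  case False
  then have "x = y \<or> end_dist x y = 1" by (simp only: end_dist_def if_False) auto
  then show ?thesis using that(1,2) by blast
qed

lemma end_dist_le:
  assumes "x \<in> end_set X \<Phi>" "y \<in> end_set X \<Phi>" "n \<ge> 1" "x n = y n"
  shows "end_dist x y \<le> 1 / 2 ^ n"
proof (cases "x = y")
  case False
  then have "n \<le> Max {n. n \<ge> 1 \<and> x n = y n}"
    using finite_agree[OF assms(1,2)] assms(3,4) by (intro Max_ge) auto
  then have "(2::real) ^ n \<le> 2 ^ Max {n. n \<ge> 1 \<and> x n = y n}" by simp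
  moreover have "end_dist x y = 1 / 2 ^ Max {n. n \<ge> 1 \<and> x n = y n}"
    using False assms(3,4) by (auto simp: end_dist_def)
  ultimately show ?thesis by (simp add: frac_le)
qed (simp add: end_dist_def)

lemma end_dist_le_1: "end_dist x y \<le> 1"
  by (simp add: end_dist_def)

lemma end_dist_nonneg: "0 \<le> end_dist x y"
  by (simp add: end_dist_def)

lemma end_dist_commute: "end_dist x y = end_dist y x"
proof -
  have "(x n = y n) = (y n = x n)" for n by (rule eq_commute)
  moreover have "(x = y) = (y = x)" by (rule eq_commute)
  ultimately show ?thesis unfolding end_dist_def by presburger
qed

lemma end_dist_ultra:
  assumes x: "x \<in> end_set X \<Phi>" and y: "y \<in> end_set X \<Phi>" and z: "z \<in> end_set X \<Phi>"
  shows "end_dist x z \<le> max (end_dist x y) (end_dist y z)"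
proof (rule end_dist_cases[OF x y])
  assume "x = y"
  then show ?thesis by simp
next
  assume "end_dist x y = 1"
  then show ?thesis using end_dist_le_1[of x z] by simp
next
  fix a assume a: "a \<ge> 1" "x a = y a" "end_dist x y = 1 / 2 ^ a"
  show ?thesis
  proof (rule end_dist_cases[OF y z])
    assume "y = z"
    then show ?thesis by simp
  next
    assume "end_dist y z = 1"
    then show ?thesis using end_dist_le_1[of x z] by simp
  next
    fix b assume b: "b \<ge> 1" "y b = z b" "end_dist y z = 1 / 2 ^ b"
    have "x (min a b) = y (min a b)"
      using end_set_agree_below[OF x y a(2)] a(1) b(1) by simp
    also have "\<dots> = z (min a b)"
      using end_set_agree_below[OF y z b(2)] a(1) b(1) by simp
    finally have "end_dist x z \<le> 1 / 2 ^ min a b"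
      using end_dist_le[OF x z] a(1) b(1) by simp
    then show ?thesis using a(3) b(3) by (auto simp: min_def split: if_splits)
  qed
qed

lemma Metric_space_end: "Metric_space (end_set X \<Phi>) end_dist"
proof
  fix x y :: "nat \<Rightarrow> 'a"
  show "0 \<le> end_dist x y" by (rule end_dist_nonneg)
  show "end_dist x y = end_dist y x" by (rule end_dist_commute)
  show "end_dist x y = 0 \<longleftrightarrow> x = y" by (auto simp: end_dist_def)
next
  fix x y z :: "nat \<Rightarrow> 'a"
  assume "x \<in> end_set X \<Phi>" "y \<in> end_set X \<Phi>" "z \<in> end_set X \<Phi>"
  then show "end_dist x z \<le> end_dist x y + end_dist y z"
    using end_dist_ultra[of x X \<Phi> y z] end_dist_nonneg[of x y] end_dist_nonneg[of y z]
    by linarith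
qed

lemma mspace_end_space [simp]: "mspace (end_space X \<Phi>) = end_set X \<Phi>"
  by (simp add: end_space_def Metric_space.mspace_metric Metric_space_end)

lemma mdist_end_space [simp]: "mdist (end_space X \<Phi>) = end_dist"
  by (simp add: end_space_def Metric_space.mdist_metric Metric_space_end)

end

theory Submission
  imports Defs
begin

text \<open>
  In an end space, having distance at most \<open>1 / 2 ^ n\<close> means agreeing at index \<open>n\<close>. So a map
  between end spaces is uniformly continuous iff every coordinate of its value depends on a
  single coordinate of its argument, that is, iff it is induced by maps between the sets of the
  two chains (\<open>uniformly_continuous_end_iff\<close>, \<open>factor_through_coordinate\<close>).

  A zig-zag chain has a subchain in common with \<open>X\<close> (its odd terms) and one in common with \<open>Y\<close>
  (its even terms). Since the coordinates of an end along a subchain determine all the others,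
  passing to a subchain does not change the end space up to uniform homeomorphism
  (\<open>uniformly_homeomorphic_subchain\<close>). Hence the end spaces of \<open>X\<close>, of the zig-zag chain and of
  \<open>Y\<close> are uniformly homeomorphic.

  Conversely, let \<open>f\<close> be a uniform homeomorphism with inverse \<open>g\<close>. Start at
  \<open>\<alpha> 1 = 1\<close>; uniform continuity of \<open>g\<close> gives \<open>\<beta> 1\<close> such that the coordinate \<open>\<alpha> 1\<close> of \<open>g y\<close>
  depends only on the coordinate \<open>\<beta> 1\<close> of \<open>y\<close>; uniform continuity of \<open>f\<close> then gives \<open>\<alpha> 2\<close> such
  that the coordinate \<open>\<beta> 1\<close> of \<open>f x\<close> depends only on the coordinate \<open>\<alpha> 2\<close> of \<open>x\<close>, and so on. The
  maps between the sets that express these dependences form the zig-zag, and its triangles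
  commute because \<open>f\<close> and \<open>g\<close> are inverse to each other. Every element of a set of the chain is a
  coordinate of some end (\<open>end_set_proj\<close>), so these maps are defined everywhere and are
  surjective.
\<close>

section \<open>Uniform homeomorphisms\<close>

lemma uniformly_homeomorphic_iff:
  "uniformly_homeomorphic m1 m2 \<longleftrightarrow>
     (\<exists>f g. uniformly_continuous_map m1 m2 f \<and> uniformly_continuous_map m2 m1 g \<and>
        (\<forall>x \<in> mspace m1. g (f x) = x) \<and> (\<forall>y \<in> mspace m2. f (g y) = y))"
proof
  assume "uniformly_homeomorphic m1 m2"
  then obtain f where "bij_betw f (mspace m1) (mspace m2)" "uniformly_continuous_map m1 m2 f"
    "uniformly_continuous_map m2 m1 (inv_into (mspace m1) f)"
    unfolding uniformly_homeomorphic_def by blast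
  then show "\<exists>f g. uniformly_continuous_map m1 m2 f \<and> uniformly_continuous_map m2 m1 g \<and>
        (\<forall>x \<in> mspace m1. g (f x) = x) \<and> (\<forall>y \<in> mspace m2. f (g y) = y)"
    by (intro exI[of _ f] exI[of _ "inv_into (mspace m1) f"])
      (simp add: bij_betw_inv_into_left bij_betw_inv_into_right)
next
  assume "\<exists>f g. uniformly_continuous_map m1 m2 f \<and> uniformly_continuous_map m2 m1 g \<and>
        (\<forall>x \<in> mspace m1. g (f x) = x) \<and> (\<forall>y \<in> mspace m2. f (g y) = y)"
  then obtain f g where f: "uniformly_continuous_map m1 m2 f"
    and g: "uniformly_continuous_map m2 m1 g"
    and gf: "\<forall>x \<in> mspace m1. g (f x) = x" and fg: "\<forall>y \<in> mspace m2. f (g y) = y"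
    by blast
  have bij: "bij_betw f (mspace m1) (mspace m2)"
    using uniformly_continuous_map_funspace[OF f] uniformly_continuous_map_funspace[OF g] gf fg
    by (intro bij_betw_byWitness[where f' = g]) auto
  have "inv_into (mspace m1) f y = g y" if "y \<in> mspace m2" for y
    using that uniformly_continuous_map_funspace[OF g] fg bij
    by (intro inv_into_f_eq) (auto simp: bij_betw_def)
  then have "uniformly_continuous_map m2 m1 (inv_into (mspace m1) f)"
    using uniformly_continuous_map_eq[OF _ g] by metis
  with bij f show "uniformly_homeomorphic m1 m2"
    unfolding uniformly_homeomorphic_def by blast
qed

lemma uniformly_homeomorphic_sym:
  "uniformly_homeomorphic m1 m2 \<Longrightarrow> uniformly_homeomorphic m2 m1"
  unfolding uniformly_homeomorphic_iff by blast

lemma uniformly_homeomorphic_trans: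
  assumes "uniformly_homeomorphic m1 m2" "uniformly_homeomorphic m2 m3"
  shows "uniformly_homeomorphic m1 m3"
proof -
  obtain f g where fg: "uniformly_continuous_map m1 m2 f" "uniformly_continuous_map m2 m1 g"
    "\<forall>x \<in> mspace m1. g (f x) = x" "\<forall>y \<in> mspace m2. f (g y) = y"
    using assms(1) unfolding uniformly_homeomorphic_iff by blast
  obtain h k where hk: "uniformly_continuous_map m2 m3 h" "uniformly_continuous_map m3 m2 k"
    "\<forall>x \<in> mspace m2. k (h x) = x" "\<forall>y \<in> mspace m3. h (k y) = y"
    using assms(2) unfolding uniformly_homeomorphic_iff by blast
  have "f x \<in> mspace m2" if "x \<in> mspace m1" for x
    using that uniformly_continuous_map_funspace[OF fg(1)] by blast
  moreover have "k z \<in> mspace m2" if "z \<in> mspace m3" for z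
    using that uniformly_continuous_map_funspace[OF hk(2)] by blast
  ultimately show ?thesis
    unfolding uniformly_homeomorphic_iff
    using fg hk uniformly_continuous_map_compose[OF fg(1) hk(1)]
      uniformly_continuous_map_compose[OF hk(2) fg(2)]
    by (intro exI[of _ "h \<circ> f"] exI[of _ "g \<circ> k"]) simp
qed

section \<open>Uniform continuity on end spaces\<close>

lemma end_dist_less_imp_agree:
  assumes "x \<in> end_set X \<Phi>" "y \<in> end_set X \<Phi>" "n \<ge> 1" "end_dist x y < 1 / 2 ^ n"
  shows "x n = y n"
proof (rule end_dist_cases[OF assms(1,2)])
  assume "end_dist x y = 1"
  moreover have "1 / 2 ^ n \<le> (1::real)" by simp
  ultimately show ?thesis using assms(4) by linarith
next
  fix k assume k: "k \<ge> 1" "x k = y k" "end_dist x y = 1 / 2 ^ k"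
  then have "(1::real) / 2 ^ k < 1 / 2 ^ n" using assms(4) by simp
  then have "n \<le> k" by (simp add: divide_simps)
  then show ?thesis using end_set_agree_below[OF assms(1,2) k(2)] assms(3) by simp
qed simp

lemma ex_power_two_less:
  assumes "\<delta> > (0::real)"
  shows "\<exists>m\<ge>1. 1 / 2 ^ m < \<delta>"
proof -
  obtain m where m: "(1 / 2) ^ m < \<delta>"
    using real_arch_pow_inv[OF assms, of "1 / 2"] by auto
  have "(1 / 2 :: real) ^ Suc m \<le> (1 / 2) ^ m" by simp
  with m have "1 / 2 ^ Suc m < \<delta>" by (simp only: power_one_over)
  then show ?thesis by (intro exI[of _ "Suc m"]) simp
qed

text \<open>
  Agreement at \<open>m\<close> bounds the distance by \<open>1 / 2 ^ m\<close>, and conversely a distance below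
  \<open>1 / 2 ^ m\<close> forces agreement at \<open>m\<close>; so \<open>m\<close> plays the role of \<open>\<delta>\<close> and \<open>k\<close> that of \<open>\<epsilon>\<close>.
\<close>

lemma uniformly_continuous_end_iff:
  "uniformly_continuous_map (end_space X \<Phi>) (end_space Y \<Psi>) f \<longleftrightarrow>
     f \<in> end_set X \<Phi> \<rightarrow> end_set Y \<Psi> \<and>
     (\<forall>k\<ge>1. \<exists>m\<ge>1. \<forall>x \<in> end_set X \<Phi>. \<forall>x' \<in> end_set X \<Phi>. x m = x' m \<longrightarrow> f x k = f x' k)"
    (is "_ \<longleftrightarrow> ?F \<and> ?U")
proof (intro iffI conjI)
  assume u: "uniformly_continuous_map (end_space X \<Phi>) (end_space Y \<Psi>) f"
  then show F: ?F using uniformly_continuous_map_funspace by fastforce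
  show ?U
  proof (intro allI impI)
    fix k :: nat assume k: "k \<ge> 1"
    have "0 < (1::real) / 2 ^ k" by simp
    then obtain \<delta> where \<delta>: "\<delta> > 0"
      "\<And>x x'. x \<in> end_set X \<Phi> \<Longrightarrow> x' \<in> end_set X \<Phi> \<Longrightarrow> end_dist x' x < \<delta> \<Longrightarrow>
         end_dist (f x') (f x) < 1 / 2 ^ k"
      using u unfolding uniformly_continuous_map_def mspace_end_space mdist_end_space by meson
    obtain m where m: "m \<ge> 1" "1 / 2 ^ m < \<delta>"
      using ex_power_two_less[OF \<open>\<delta> > 0\<close>] by blast
    have "f x k = f x' k"
      if "x \<in> end_set X \<Phi>" "x' \<in> end_set X \<Phi>" "x m = x' m" for x x'
    proof -
      have "end_dist x x' < \<delta>"
        using end_dist_le[OF that(1,2) m(1) that(3)] m(2) by linarith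
      then show ?thesis
        using end_dist_less_imp_agree[OF _ _ k \<delta>(2)[OF that(2,1)]] F that(1,2) by blast
    qed
    then show "\<exists>m\<ge>1. \<forall>x \<in> end_set X \<Phi>. \<forall>x' \<in> end_set X \<Phi>. x m = x' m \<longrightarrow> f x k = f x' k"
      using m(1) by blast
  qed
next
  assume *: "?F \<and> ?U"
  show "uniformly_continuous_map (end_space X \<Phi>) (end_space Y \<Psi>) f"
    unfolding uniformly_continuous_map_def mspace_end_space mdist_end_space
  proof (intro conjI allI impI)
    show ?F using * by blast
    fix \<epsilon> :: real assume "\<epsilon> > 0"
    then obtain k where k: "k \<ge> 1" "1 / 2 ^ k < \<epsilon>"
      using ex_power_two_less by blast
    obtain m where m: "m \<ge> 1"
      "\<And>x x'. x \<in> end_set X \<Phi> \<Longrightarrow> x' \<in> end_set X \<Phi> \<Longrightarrow> x m = x' m \<Longrightarrow> f x k = f x' k"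
      using * k(1) by meson
    have "end_dist (f x') (f x) < \<epsilon>"
      if "x \<in> end_set X \<Phi>" "x' \<in> end_set X \<Phi>" "end_dist x' x < 1 / 2 ^ m" for x x'
    proof -
      have "x' m = x m"
        using end_dist_less_imp_agree[OF that(2,1) m(1) that(3)] .
      then have "end_dist (f x') (f x) \<le> 1 / 2 ^ k"
        using m(2)[OF that(2,1)] * that(1,2) k(1) by (intro end_dist_le[of _ Y \<Psi>]) auto
      then show ?thesis using k(2) by linarith
    qed
    then show "\<exists>\<delta>>0. \<forall>x \<in> end_set X \<Phi>. \<forall>x' \<in> end_set X \<Phi>.
        end_dist x' x < \<delta> \<longrightarrow> end_dist (f x') (f x) < \<epsilon>"
      by (intro exI[of _ "1 / 2 ^ m"]) simp
  qed
qed

text \<open>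
  The witness can be taken beyond \<open>k\<close>, because agreement at a larger index implies agreement
  at a smaller one. This is what makes the index sequences of the zig-zag strictly increasing.
\<close>

lemma uniformly_continuous_end_modulus:
  assumes "uniformly_continuous_map (end_space X \<Phi>) (end_space Y \<Psi>) f" "k \<ge> 1"
  obtains m where "m > k"
    "\<And>x x'. x \<in> end_set X \<Phi> \<Longrightarrow> x' \<in> end_set X \<Phi> \<Longrightarrow> x m = x' m \<Longrightarrow> f x k = f x' k"
proof -
  obtain m where m: "m \<ge> 1"
    "\<And>x x'. x \<in> end_set X \<Phi> \<Longrightarrow> x' \<in> end_set X \<Phi> \<Longrightarrow> x m = x' m \<Longrightarrow> f x k = f x' k"
    using assms unfolding uniformly_continuous_end_iff by meson
  show ?thesis
  proof (rule that[of "max m (Suc k)"])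
    fix x x' assume x: "x \<in> end_set X \<Phi>" "x' \<in> end_set X \<Phi>"
      and "x (max m (Suc k)) = x' (max m (Suc k))"
    then have "x m = x' m" using end_set_agree_below[OF x _ m(1)] by simp
    with m(2) x show "f x k = f x' k" by blast
  qed simp
qed

section \<open>Subchains\<close>

lemma increasing_seq_pos: "increasing_seq \<alpha> \<Longrightarrow> n \<ge> 1 \<Longrightarrow> \<alpha> n \<ge> 1"
  unfolding increasing_seq_def by auto

lemma increasing_seq_less: "increasing_seq \<alpha> \<Longrightarrow> 1 \<le> m \<Longrightarrow> m < n \<Longrightarrow> \<alpha> m < \<alpha> n"
  unfolding increasing_seq_def using strict_mono_onD[of "{1..}" \<alpha> m n] by simp

lemma increasing_seq_le: "increasing_seq \<alpha> \<Longrightarrow> 1 \<le> m \<Longrightarrow> m \<le> n \<Longrightarrow> \<alpha> m \<le> \<alpha> n"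
  using increasing_seq_less[of \<alpha> m n] by (cases "m = n") auto

lemma increasing_seq_ge_index:
  assumes "increasing_seq \<alpha>" "n \<ge> 1"
  shows "n \<le> \<alpha> n"
  using assms(2)
proof (induction rule: dec_induct)
  case base
  show ?case using increasing_seq_pos[OF assms(1)] by simp
next
  case (step n)
  then show ?case using increasing_seq_less[OF assms(1), of n "Suc n"] by simp
qed

lemma increasing_seqI:
  assumes "\<alpha> 1 \<ge> 1" and step: "\<And>n. n \<ge> 1 \<Longrightarrow> \<alpha> n < \<alpha> (Suc n)"
  shows "increasing_seq \<alpha>"
proof -
  have less: "\<alpha> m < \<alpha> n" if "m < n" "m \<ge> 1" for m n
    using that
  proof (induction n)
    case (Suc n)
    then show ?case using step[of n] by (cases "m = n") auto
  qed simp
  moreover have "\<alpha> n \<ge> 1" if "n \<ge> 1" for n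
    using that assms(1) less[of 1 n] by (cases "n = 1") auto
  ultimately show ?thesis
    unfolding increasing_seq_def by (auto intro!: strict_mono_onI)
qed

lemma bond_add: "bond \<Phi> m (d + e) x = bond \<Phi> m d (bond \<Phi> (m + d) e x)"
  by (induction e arbitrary: x) (simp_all add: add.assoc)

lemma bond_Suc_left: "bond \<Phi> m (Suc d) x = \<Phi> m (bond \<Phi> (Suc m) d x)"
  using bond_add[of \<Phi> m 1 d x] by simp

lemma bond_two: "bond \<Phi> m 2 x = \<Phi> m (\<Phi> (Suc m) x)"
  by (simp add: numeral_2_eq_2)

lemma bond_in_chain:
  assumes "D_chain X \<Phi>" "m \<ge> 1" "x \<in> X (m + d)"
  shows "bond \<Phi> m d x \<in> X m"
  using assms(3)
proof (induction d arbitrary: x)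
  case (Suc d)
  have "\<Phi> (m + d) ` X (m + d + 1) = X (m + d)"
    using assms(1,2) unfolding D_chain_def by simp
  then show ?case using Suc by auto
qed simp

lemma bond_end:
  assumes "x \<in> end_set X \<Phi>" "m \<ge> 1"
  shows "bond \<Phi> m d (x (m + d)) = x m"
proof (induction d)
  case (Suc d)
  have "\<Phi> (m + d) (x (m + d + 1)) = x (m + d)"
    using assms unfolding end_set_def by simp
  then show ?case using Suc by simp
qed simp

lemma subchain_map_end:
  assumes "increasing_seq \<alpha>" "x \<in> end_set X \<Phi>" "n \<ge> 1"
  shows "subchain_map \<Phi> \<alpha> n (x (\<alpha> (n + 1))) = x (\<alpha> n)"
  using bond_end[OF assms(2), of "\<alpha> n" "\<alpha> (n + 1) - \<alpha> n"]
    increasing_seq_pos[OF assms(1,3)] increasing_seq_less[OF assms(1,3), of "n + 1"]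
  unfolding subchain_map_def by simp

lemma restrict_end_subchain:
  assumes "increasing_seq \<alpha>" "x \<in> end_set X \<Phi>"
  shows "(\<lambda>n \<in> {1..}. x (\<alpha> n)) \<in> end_set (subchain_set X \<alpha>) (subchain_map \<Phi> \<alpha>)"
proof -
  have "x (\<alpha> n) \<in> X (\<alpha> n)" if "n \<ge> 1" for n
    using assms(2) increasing_seq_pos[OF assms(1) that] unfolding end_set_def by auto
  moreover have "subchain_map \<Phi> \<alpha> n (x (\<alpha> (n + 1))) = x (\<alpha> n)" if "n \<ge> 1" for n
    using subchain_map_end[OF assms that] .
  ultimately show ?thesis
    unfolding end_set_def by (auto simp: subchain_set_def)
qed

text \<open>
  The \<open>j\<close>-th coordinate is obtained by pushing some \<open>w n\<close> with \<open>\<alpha> n \<ge> j\<close> down to \<open>X j\<close>. The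
  result is the same for all such \<open>n\<close>, and \<open>n = j\<close> is one of them because \<open>j \<le> \<alpha> j\<close>.
\<close>

lemma extend_end_subchain:
  assumes chain: "D_chain X \<Phi>" and \<alpha>: "increasing_seq \<alpha>"
    and w: "w \<in> end_set (subchain_set X \<alpha>) (subchain_map \<Phi> \<alpha>)"
  shows "(\<lambda>j \<in> {1..}. bond \<Phi> j (\<alpha> j - j) (w j)) \<in> end_set X \<Phi>" (is "?x \<in> _")
    and "n \<ge> 1 \<Longrightarrow> bond \<Phi> (\<alpha> n) (\<alpha> (\<alpha> n) - \<alpha> n) (w (\<alpha> n)) = w n"
proof -
  have indep: "bond \<Phi> j (\<alpha> n - j) (w n) = bond \<Phi> j (\<alpha> m - j) (w m)"
    if m: "1 \<le> m" "j \<le> \<alpha> m" and "m \<le> n" for j m n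
    using \<open>m \<le> n\<close>
  proof (induction rule: dec_induct)
    case (step n)
    have n: "1 \<le> n" "\<alpha> m \<le> \<alpha> n" "\<alpha> n < \<alpha> (Suc n)"
      using step m increasing_seq_le[OF \<alpha>, of m n] increasing_seq_less[OF \<alpha>, of n "Suc n"]
      by auto
    have "bond \<Phi> j (\<alpha> (Suc n) - j) (w (Suc n))
        = bond \<Phi> j (\<alpha> n - j) (bond \<Phi> (\<alpha> n) (\<alpha> (Suc n) - \<alpha> n) (w (Suc n)))"
      using bond_add[of \<Phi> j "\<alpha> n - j" "\<alpha> (Suc n) - \<alpha> n" "w (Suc n)"] n m by simp
    also have "bond \<Phi> (\<alpha> n) (\<alpha> (Suc n) - \<alpha> n) (w (Suc n)) = w n"
      using w n(1) unfolding end_set_def subchain_map_def by simp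
    finally show ?case using step by simp
  qed simp
  show "bond \<Phi> (\<alpha> n) (\<alpha> (\<alpha> n) - \<alpha> n) (w (\<alpha> n)) = w n" if "n \<ge> 1" for n
    using indep[of n "\<alpha> n" "\<alpha> n"] that increasing_seq_ge_index[OF \<alpha> that] by simp
  have "bond \<Phi> j (\<alpha> j - j) (w j) \<in> X j" if "j \<ge> 1" for j
    using that w increasing_seq_ge_index[OF \<alpha> that]
    by (intro bond_in_chain[OF chain]) (auto simp: end_set_def subchain_set_def)
  moreover have "\<Phi> j (bond \<Phi> (Suc j) (\<alpha> (Suc j) - Suc j) (w (Suc j))) = bond \<Phi> j (\<alpha> j - j) (w j)"
    if "j \<ge> 1" for j
  proof -
    have "Suc (\<alpha> (Suc j) - Suc j) = \<alpha> (Suc j) - j"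
      using increasing_seq_ge_index[OF \<alpha>, of "Suc j"] by simp
    then have "\<Phi> j (bond \<Phi> (Suc j) (\<alpha> (Suc j) - Suc j) (w (Suc j)))
        = bond \<Phi> j (\<alpha> (Suc j) - j) (w (Suc j))"
      by (metis bond_Suc_left)
    also have "\<dots> = bond \<Phi> j (\<alpha> j - j) (w j)"
      using that increasing_seq_ge_index[OF \<alpha> that] by (intro indep) auto
    finally show ?thesis .
  qed
  ultimately show "?x \<in> end_set X \<Phi>"
    unfolding end_set_def by simp
qed

text \<open>
  Restriction to the indices \<open>\<alpha> n\<close> is a uniform homeomorphism: its inverse reconstructs
  the remaining coordinates by \<open>extend_end_subchain\<close>.
\<close>

lemma uniformly_homeomorphic_subchain:
  assumes chain: "D_chain X \<Phi>" and \<alpha>: "increasing_seq \<alpha>"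
  shows "uniformly_homeomorphic (end_space X \<Phi>)
           (end_space (subchain_set X \<alpha>) (subchain_map \<Phi> \<alpha>))"
proof -
  let ?E = "end_set X \<Phi>" and ?S = "end_set (subchain_set X \<alpha>) (subchain_map \<Phi> \<alpha>)"
  define r where "r x = (\<lambda>n \<in> {1..}. x (\<alpha> n))" for x :: "nat \<Rightarrow> 'a"
  define e where "e w = (\<lambda>j \<in> {1..}. bond \<Phi> j (\<alpha> j - j) (w j))" for w
  have r: "r \<in> ?E \<rightarrow> ?S"
    using restrict_end_subchain[OF \<alpha>] unfolding r_def by auto
  have e: "e \<in> ?S \<rightarrow> ?E"
    using extend_end_subchain(1)[OF chain \<alpha>] unfolding e_def by auto
  have "uniformly_continuous_map (end_space X \<Phi>)
      (end_space (subchain_set X \<alpha>) (subchain_map \<Phi> \<alpha>)) r"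
    unfolding uniformly_continuous_end_iff
  proof (intro conjI r allI impI)
    fix k :: nat assume "k \<ge> 1"
    then show "\<exists>m\<ge>1. \<forall>x \<in> ?E. \<forall>x' \<in> ?E. x m = x' m \<longrightarrow> r x k = r x' k"
      using increasing_seq_pos[OF \<alpha>] by (intro exI[of _ "\<alpha> k"]) (simp add: r_def)
  qed
  moreover have "uniformly_continuous_map
      (end_space (subchain_set X \<alpha>) (subchain_map \<Phi> \<alpha>)) (end_space X \<Phi>) e"
    unfolding uniformly_continuous_end_iff
  proof (intro conjI e allI impI)
    fix k :: nat assume "k \<ge> 1"
    then show "\<exists>m\<ge>1. \<forall>w \<in> ?S. \<forall>w' \<in> ?S. w m = w' m \<longrightarrow> e w k = e w' k"
      by (intro exI[of _ k]) (simp add: e_def)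
  qed
  moreover have "e (r x) = x" if x: "x \<in> ?E" for x
  proof (rule PiE_ext[where k = "{1..}" and s = X])
    have "e (r x) \<in> ?E" using x r e by blast
    with x show "e (r x) \<in> PiE {1..} X" "x \<in> PiE {1..} X"
      unfolding end_set_def by (simp_all only: mem_Collect_eq)
    fix j :: nat assume "j \<in> {1..}"
    then show "e (r x) j = x j"
      using bond_end[OF x, of j "\<alpha> j - j"] increasing_seq_ge_index[OF \<alpha>, of j]
      by (simp add: e_def r_def)
  qed
  moreover have "r (e w) = w" if w: "w \<in> ?S" for w
  proof (rule PiE_ext[where k = "{1..}" and s = "subchain_set X \<alpha>"])
    have "r (e w) \<in> ?S" using w r e by blast
    with w show "r (e w) \<in> PiE {1..} (subchain_set X \<alpha>)" "w \<in> PiE {1..} (subchain_set X \<alpha>)"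
      unfolding end_set_def by (simp_all only: mem_Collect_eq)
    fix n :: nat assume "n \<in> {1..}"
    then show "r (e w) n = w n"
      using extend_end_subchain(2)[OF chain \<alpha> w, of n] increasing_seq_pos[OF \<alpha>, of n]
      by (simp add: e_def r_def)
  qed
  ultimately show ?thesis
    unfolding uniformly_homeomorphic_iff mspace_end_space by blast
qed

text \<open>
  Only the values of the maps on the sets of the chain enter the end space. This allows
  a subchain of a zig-zag chain to be identified with a subchain of one of its two chains.
\<close>

lemma end_space_cong:
  assumes sets: "\<And>n. n \<ge> 1 \<Longrightarrow> X n = Y n"
    and maps: "\<And>n x. n \<ge> 1 \<Longrightarrow> x \<in> X (n + 1) \<Longrightarrow> \<Phi> n x = \<Psi> n x"
  shows "end_space X \<Phi> = end_space Y \<Psi>"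
proof -
  have PiE: "PiE {1..} X = PiE {1..} Y"
    using sets by (intro PiE_cong) simp
  have "\<Phi> n (x (n + 1)) = \<Psi> n (x (n + 1))" if "x \<in> PiE {1..} X" "n \<ge> 1" for x n
    using that by (intro maps) auto
  then have "end_set X \<Phi> = end_set Y \<Psi>"
    unfolding end_set_def PiE[symmetric] by (intro Collect_cong) auto
  then show ?thesis by (simp add: end_space_def)
qed

section \<open>From a zig-zag to a uniform homeomorphism\<close>

lemma common_zigzag_imp_uniformly_homeomorphic:
  assumes X: "D_chain X \<Phi>" and Y: "D_chain Y \<Psi>" and zz: "common_zigzag Z V X \<Phi> Y \<Psi>"
  shows "uniformly_homeomorphic (end_space X \<Phi>) (end_space Y \<Psi>)"
proof -
  obtain \<alpha> \<beta> where Z: "D_chain Z V" and \<alpha>: "increasing_seq \<alpha>" and \<beta>: "increasing_seq \<beta>"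
    and sets: "\<And>n. n \<ge> 1 \<Longrightarrow> Z (2 * n - 1) = subchain_set X \<alpha> n"
      "\<And>n. n \<ge> 1 \<Longrightarrow> Z (2 * n) = subchain_set Y \<beta> n"
    and VX: "\<And>n x. n \<ge> 1 \<Longrightarrow> x \<in> subchain_set X \<alpha> (n + 1) \<Longrightarrow>
        V (2 * n - 1) (V (2 * n) x) = subchain_map \<Phi> \<alpha> n x"
    and VY: "\<And>n y. n \<ge> 1 \<Longrightarrow> y \<in> subchain_set Y \<beta> (n + 1) \<Longrightarrow>
        V (2 * n) (V (2 * n + 1) y) = subchain_map \<Psi> \<beta> n y"
    using zz unfolding common_zigzag_def by auto
  let ?odd = "\<lambda>n::nat. 2 * n - 1" and ?even = "\<lambda>n::nat. 2 * n"
  have odd: "increasing_seq ?odd" and even: "increasing_seq ?even"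
    by (rule increasing_seqI; simp)+
  have odd_sets: "subchain_set Z ?odd n = subchain_set X \<alpha> n" if "n \<ge> 1" for n
    using sets(1)[OF that] by (simp only: subchain_set_def)
  have even_sets: "subchain_set Z ?even n = subchain_set Y \<beta> n" if "n \<ge> 1" for n
    using sets(2)[OF that] by (simp only: subchain_set_def)
  have odd_maps: "subchain_map V ?odd n x = subchain_map \<Phi> \<alpha> n x"
    if "n \<ge> 1" "x \<in> subchain_set X \<alpha> (n + 1)" for n x
  proof -
    have "2 * (n + 1) - 1 - (2 * n - 1) = 2" "Suc (2 * n - 1) = 2 * n"
      using that(1) by simp_all
    then show ?thesis
      using VX[OF that] unfolding subchain_map_def by (simp only: bond_two)
  qed
  have oddX: "end_space (subchain_set Z ?odd) (subchain_map V ?odd)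
      = end_space (subchain_set X \<alpha>) (subchain_map \<Phi> \<alpha>)"
    by (rule end_space_cong[OF odd_sets odd_maps]) (simp_all only: odd_sets le_add2)
  have even_maps: "subchain_map V ?even n y = subchain_map \<Psi> \<beta> n y"
    if "n \<ge> 1" "y \<in> subchain_set Y \<beta> (n + 1)" for n y
  proof -
    have "2 * (n + 1) - 2 * n = 2" by simp
    then show ?thesis
      using VY[OF that] unfolding subchain_map_def by (simp add: bond_two)
  qed
  have evenY: "end_space (subchain_set Z ?even) (subchain_map V ?even)
      = end_space (subchain_set Y \<beta>) (subchain_map \<Psi> \<beta>)"
    by (rule end_space_cong[OF even_sets even_maps]) (simp_all only: even_sets le_add2)
  have "uniformly_homeomorphic (end_space X \<Phi>) (end_space Z V)"
    using uniformly_homeomorphic_subchain[OF X \<alpha>] uniformly_homeomorphic_subchain[OF Z odd]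
    unfolding oddX by (blast intro: uniformly_homeomorphic_trans uniformly_homeomorphic_sym)
  moreover have "uniformly_homeomorphic (end_space Z V) (end_space Y \<Psi>)"
    using uniformly_homeomorphic_subchain[OF Y \<beta>] uniformly_homeomorphic_subchain[OF Z even]
    unfolding evenY by (blast intro: uniformly_homeomorphic_trans uniformly_homeomorphic_sym)
  ultimately show ?thesis by (rule uniformly_homeomorphic_trans)
qed

section \<open>From a uniform homeomorphism to a zig-zag\<close>

text \<open>
  Surjectivity of the maps lets one lift an element of \<open>X m\<close> step by step to an end of the
  subchain \<open>X m, X (m + 1), \<dots>\<close>, which extends to an end of the whole chain.
\<close>

lemma end_set_proj:
  assumes chain: "D_chain X \<Phi>" and m: "m \<ge> 1"
  shows "(\<lambda>x. x m) ` end_set X \<Phi> = X m"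
proof (intro equalityI subsetI)
  fix a assume "a \<in> (\<lambda>x. x m) ` end_set X \<Phi>"
  then show "a \<in> X m" using m unfolding end_set_def by auto
next
  fix a assume a: "a \<in> X m"
  have "\<exists>u. \<forall>n. (u n \<in> X (m + n) \<and> (n = 0 \<longrightarrow> u n = a)) \<and> \<Phi> (m + n) (u (Suc n)) = u n"
  proof (rule dependent_nat_choice)
    show "\<exists>x. x \<in> X (m + 0) \<and> (0 = (0::nat) \<longrightarrow> x = a)" using a by simp
    fix x n assume "x \<in> X (m + n) \<and> (n = 0 \<longrightarrow> x = a)"
    moreover have "\<Phi> (m + n) ` X (m + n + 1) = X (m + n)"
      using chain m unfolding D_chain_def by simp
    ultimately show "\<exists>y. (y \<in> X (m + Suc n) \<and> (Suc n = 0 \<longrightarrow> y = a)) \<and> \<Phi> (m + n) y = x"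
      by (metis Suc_eq_plus1 add.assoc imageE nat.distinct(1))
  qed
  then obtain u where u: "\<And>n. u n \<in> X (m + n)" "u 0 = a"
    "\<And>n. \<Phi> (m + n) (u (Suc n)) = u n"
    by blast
  define \<alpha> where "\<alpha> n = m + (n - 1)" for n
  have \<alpha>: "increasing_seq \<alpha>"
    using m by (intro increasing_seqI) (auto simp: \<alpha>_def)
  define w where "w = (\<lambda>n \<in> {1..}. u (n - 1))"
  have "subchain_map \<Phi> \<alpha> n (w (n + 1)) = w n" if "n \<ge> 1" for n
  proof -
    have "\<alpha> (n + 1) - \<alpha> n = Suc 0" using that by (simp add: \<alpha>_def)
    then show ?thesis
      using u(3)[of "n - 1"] that unfolding subchain_map_def by (simp add: w_def \<alpha>_def)
  qed
  moreover have "w n \<in> subchain_set X \<alpha> n" if "n \<ge> 1" for n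
    using u(1)[of "n - 1"] that by (simp add: w_def \<alpha>_def subchain_set_def)
  ultimately have w: "w \<in> end_set (subchain_set X \<alpha>) (subchain_map \<Phi> \<alpha>)"
    unfolding end_set_def by (auto simp: w_def)
  define x where "x = (\<lambda>j \<in> {1..}. bond \<Phi> j (\<alpha> j - j) (w j))"
  have "x \<in> end_set X \<Phi>"
    using extend_end_subchain(1)[OF chain \<alpha> w] unfolding x_def .
  moreover have "x m = a"
    using extend_end_subchain(2)[OF chain \<alpha> w, of 1] m u(2) by (simp add: x_def w_def \<alpha>_def)
  ultimately show "a \<in> (\<lambda>x. x m) ` end_set X \<Phi>" by blast
qed

text \<open>
  Since \<open>f x k\<close> depends only on \<open>x m\<close> and every element of \<open>X m\<close> is such an \<open>x m\<close>, the map
  \<open>x m \<mapsto> f x k\<close> is defined on all of \<open>X m\<close>. It is onto because every element of \<open>Y k\<close> is a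
  coordinate of some end, which is a value of \<open>f\<close>.
\<close>

lemma factor_through_coordinate:
  assumes X: "D_chain X \<Phi>" and Y: "D_chain Y \<Psi>" and "m \<ge> 1" "k \<ge> 1"
    and surj: "f ` end_set X \<Phi> = end_set Y \<Psi>"
    and dep: "\<And>x x'. x \<in> end_set X \<Phi> \<Longrightarrow> x' \<in> end_set X \<Phi> \<Longrightarrow> x m = x' m \<Longrightarrow> f x k = f x' k"
  obtains v where "v ` X m = Y k" "\<And>x. x \<in> end_set X \<Phi> \<Longrightarrow> v (x m) = f x k"
proof -
  define v where "v a = f (SOME x. x \<in> end_set X \<Phi> \<and> x m = a) k" for a
  have v: "v (x m) = f x k" if "x \<in> end_set X \<Phi>" for x
    unfolding v_def by (rule someI2[of _ x]) (use that in \<open>blast intro: dep\<close>)+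
  have "v ` X m = v ` (\<lambda>x. x m) ` end_set X \<Phi>"
    using end_set_proj[OF X \<open>m \<ge> 1\<close>] by simp
  also have "\<dots> = (\<lambda>y. y k) ` f ` end_set X \<Phi>"
    unfolding image_image using v by (intro image_cong) auto
  also have "\<dots> = Y k"
    using end_set_proj[OF Y \<open>k \<ge> 1\<close>] surj by simp
  finally show ?thesis using that v by blast
qed

lemma uniformly_homeomorphic_imp_common_zigzag:
  fixes X Y :: "nat \<Rightarrow> 'a set" and \<Phi> \<Psi> :: "nat \<Rightarrow> 'a \<Rightarrow> 'a"
  assumes X: "D_chain X \<Phi>" and Y: "D_chain Y \<Psi>"
    and homeo: "uniformly_homeomorphic (end_space X \<Phi>) (end_space Y \<Psi>)"
  shows "\<exists>Z V. common_zigzag Z V X \<Phi> Y \<Psi>"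
proof -
  let ?E = "end_set X \<Phi>" and ?F = "end_set Y \<Psi>"
  obtain f g where f: "uniformly_continuous_map (end_space X \<Phi>) (end_space Y \<Psi>) f"
    and g: "uniformly_continuous_map (end_space Y \<Psi>) (end_space X \<Phi>) g"
    and "\<forall>x \<in> ?E. g (f x) = x" "\<forall>y \<in> ?F. f (g y) = y"
    using homeo unfolding uniformly_homeomorphic_iff mspace_end_space by (elim exE conjE)
  then have gf: "\<And>x. x \<in> ?E \<Longrightarrow> g (f x) = x" and fg: "\<And>y. y \<in> ?F \<Longrightarrow> f (g y) = y"
    by simp_all
  have f_in: "f x \<in> ?F" if "x \<in> ?E" for x
    using that uniformly_continuous_map_funspace[OF f] by auto
  have g_in: "g y \<in> ?E" if "y \<in> ?F" for y
    using that uniformly_continuous_map_funspace[OF g] by auto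
  have f_surj: "f ` ?E = ?F"
    using f_in g_in fg by (metis (no_types) image_eqI image_subsetI subsetI subset_antisym)
  have g_surj: "g ` ?F = ?E"
    using f_in g_in gf by (metis (no_types) image_eqI image_subsetI subsetI subset_antisym)
  have "\<exists>m>k. \<forall>x \<in> ?E. \<forall>x' \<in> ?E. x m = x' m \<longrightarrow> f x k = f x' k"
    if "k \<ge> 1" for k
    by (rule uniformly_continuous_end_modulus[OF f that]) (intro exI conjI ballI impI)
  then obtain M where M: "\<And>k. k \<ge> 1 \<Longrightarrow> M k > k"
    "\<And>k x x'. k \<ge> 1 \<Longrightarrow> x \<in> ?E \<Longrightarrow> x' \<in> ?E \<Longrightarrow> x (M k) = x' (M k) \<Longrightarrow> f x k = f x' k"
    by metis
  have "\<exists>m>k. \<forall>y \<in> ?F. \<forall>y' \<in> ?F. y m = y' m \<longrightarrow> g y k = g y' k"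
    if "k \<ge> 1" for k
    by (rule uniformly_continuous_end_modulus[OF g that]) (intro exI conjI ballI impI)
  then obtain N where N: "\<And>k. k \<ge> 1 \<Longrightarrow> N k > k"
    "\<And>k y y'. k \<ge> 1 \<Longrightarrow> y \<in> ?F \<Longrightarrow> y' \<in> ?F \<Longrightarrow> y (N k) = y' (N k) \<Longrightarrow> g y k = g y' k"
    by metis

  \<comment> \<open>The indices \<open>\<alpha> 1 < \<beta> 1 < \<alpha> 2 < \<beta> 2 < \<dots>\<close> with \<open>\<beta> n = N (\<alpha> n)\<close> and \<open>\<alpha> (n + 1) = M (\<beta> n)\<close>.\<close>
  define \<alpha> where "\<alpha> n = ((M \<circ> N) ^^ (n - 1)) 1" for n
  define \<beta> where "\<beta> n = N (\<alpha> n)" for n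
  have \<alpha>_Suc: "\<alpha> (Suc n) = M (\<beta> n)" if "n \<ge> 1" for n
    using that by (cases n) (simp_all add: \<alpha>_def \<beta>_def)
  have \<alpha>_pos: "\<alpha> n \<ge> 1" if "n \<ge> 1" for n
    using that
  proof (induction rule: dec_induct)
    case (step n)
    then show ?case using N(1)[of "\<alpha> n"] M(1)[of "\<beta> n"] \<alpha>_Suc[of n] by (simp add: \<beta>_def)
  qed (simp add: \<alpha>_def)
  have less: "\<alpha> n < \<beta> n" "\<beta> n < \<alpha> (Suc n)" if "n \<ge> 1" for n
    using that \<alpha>_pos[OF that] N(1)[of "\<alpha> n"] M(1)[of "\<beta> n"] \<alpha>_Suc[OF that]
    by (auto simp: \<beta>_def)
  have \<beta>_pos: "\<beta> n \<ge> 1" if "n \<ge> 1" for n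
    using less(1)[OF that] by simp
  have \<alpha>: "increasing_seq \<alpha>"
    using less by (intro increasing_seqI \<alpha>_pos) (auto intro: less_trans)
  have \<beta>: "increasing_seq \<beta>"
  proof (rule increasing_seqI)
    show "\<beta> n < \<beta> (Suc n)" if "n \<ge> 1" for n
      using less(2)[OF that] less(1)[of "Suc n"] by simp
  qed (rule \<beta>_pos, simp)

  have "\<exists>v. v ` Y (\<beta> n) = X (\<alpha> n) \<and> (\<forall>y \<in> ?F. v (y (\<beta> n)) = g y (\<alpha> n))" if "n \<ge> 1" for n
    by (rule factor_through_coordinate
        [OF Y X \<beta>_pos[OF that] \<alpha>_pos[OF that] g_surj N(2)[OF \<alpha>_pos[OF that], folded \<beta>_def]])
      blast+
  then obtain v where v: "\<And>n. n \<ge> 1 \<Longrightarrow> v n ` Y (\<beta> n) = X (\<alpha> n)"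
    "\<And>n y. n \<ge> 1 \<Longrightarrow> y \<in> ?F \<Longrightarrow> v n (y (\<beta> n)) = g y (\<alpha> n)"
    by metis
  have "\<exists>u. u ` X (\<alpha> (Suc n)) = Y (\<beta> n) \<and> (\<forall>x \<in> ?E. u (x (\<alpha> (Suc n))) = f x (\<beta> n))"
    if "n \<ge> 1" for n
    by (rule factor_through_coordinate
        [OF X Y \<alpha>_pos[of "Suc n"] \<beta>_pos[OF that] f_surj
          M(2)[OF \<beta>_pos[OF that], folded \<alpha>_Suc[OF that]]])
      (simp, blast+)
  then obtain u where u: "\<And>n. n \<ge> 1 \<Longrightarrow> u n ` X (\<alpha> (Suc n)) = Y (\<beta> n)"
    "\<And>n x. n \<ge> 1 \<Longrightarrow> x \<in> ?E \<Longrightarrow> u n (x (\<alpha> (Suc n))) = f x (\<beta> n)"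
    by metis

  \<comment> \<open>Both triangles are checked on an end through the given element.\<close>
  have vu: "v n (u n a) = subchain_map \<Phi> \<alpha> n a"
    if n: "n \<ge> 1" and a: "a \<in> X (\<alpha> (Suc n))" for n a
  proof -
    obtain x where x: "x \<in> ?E" "a = x (\<alpha> (Suc n))"
      using a end_set_proj[OF X \<alpha>_pos[of "Suc n"]] by auto
    then have "v n (u n a) = g (f x) (\<alpha> n)"
      using u(2)[OF n x(1)] v(2)[OF n f_in[OF x(1)]] by simp
    also have "\<dots> = subchain_map \<Phi> \<alpha> n a"
      using gf[OF x(1)] subchain_map_end[OF \<alpha> x(1) n] x(2) by simp
    finally show ?thesis .
  qed
  have uv: "u n (v (Suc n) b) = subchain_map \<Psi> \<beta> n b"
    if n: "n \<ge> 1" and b: "b \<in> Y (\<beta> (Suc n))" for n b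
  proof -
    obtain y where y: "y \<in> ?F" "b = y (\<beta> (Suc n))"
      using b end_set_proj[OF Y \<beta>_pos[of "Suc n"]] by auto
    then have "u n (v (Suc n) b) = f (g y) (\<beta> n)"
      using v(2)[of "Suc n" y] u(2)[OF n g_in[OF y(1)]] by simp
    also have "\<dots> = subchain_map \<Psi> \<beta> n b"
      using fg[OF y(1)] subchain_map_end[OF \<beta> y(1) n] y(2) by simp
    finally show ?thesis .
  qed

  \<comment> \<open>An odd \<open>i\<close> is \<open>2 * n - 1\<close> with \<open>n = Suc (i div 2)\<close>, an even one is \<open>2 * n\<close> with \<open>n = i div 2\<close>.\<close>
  define Z where "Z i = (if odd i then X (\<alpha> (Suc (i div 2))) else Y (\<beta> (i div 2)))" for i
  define V where "V i = (if odd i then v (Suc (i div 2)) else u (i div 2))" for i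
  have half: "odd (2 * n - 1)" "(2 * n - 1) div 2 = n - 1" if "n \<ge> 1" for n :: nat
    using that by (cases n; simp)+
  have "V i ` Z (i + 1) = Z i" if "i \<ge> 1" for i
  proof (cases "odd i")
    case True
    then have "even (i + 1)" "(i + 1) div 2 = Suc (i div 2)" by presburger+
    then show ?thesis using True v(1)[of "Suc (i div 2)"] by (simp add: Z_def V_def)
  next
    case False
    then have "odd (i + 1)" "(i + 1) div 2 = i div 2" "i div 2 \<ge> 1"
      using that by presburger+
    then show ?thesis using False u(1)[of "i div 2"] by (simp add: Z_def V_def)
  qed
  then have "D_chain Z V" unfolding D_chain_def by simp
  moreover have "Z (2 * n - 1) = subchain_set X \<alpha> n \<and> Z (2 * n) = subchain_set Y \<beta> n"
    if "n \<ge> 1" for n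
    using that half[OF that] by (simp add: Z_def subchain_set_def)
  moreover have "V (2 * n - 1) (V (2 * n) a) = subchain_map \<Phi> \<alpha> n a"
    if "n \<ge> 1" "a \<in> subchain_set X \<alpha> (n + 1)" for n a
    using that half[OF that(1)] vu[OF that(1)] by (simp add: V_def subchain_set_def)
  moreover have "V (2 * n) (V (2 * n + 1) b) = subchain_map \<Psi> \<beta> n b"
    if "n \<ge> 1" "b \<in> subchain_set Y \<beta> (n + 1)" for n b
    using that uv[OF that(1)] by (simp add: V_def subchain_set_def)
  ultimately have "common_zigzag Z V X \<Phi> Y \<Psi>"
    unfolding common_zigzag_def using \<alpha> \<beta> by blast
  then show ?thesis by blast
qed

theorem proposition5p6:
  fixes X Y :: "nat \<Rightarrow> 'a set" and \<Phi> \<Psi> :: "nat \<Rightarrow> 'a \<Rightarrow> 'a"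
  assumes "D_chain X \<Phi>" and "D_chain Y \<Psi>"
  shows "(\<exists>Z V. common_zigzag Z V X \<Phi> Y \<Psi>) \<longleftrightarrow>
         uniformly_homeomorphic (end_space X \<Phi>) (end_space Y \<Psi>)"
  using common_zigzag_imp_uniformly_homeomorphic[OF assms]
    uniformly_homeomorphic_imp_common_zigzag[OF assms] by blast

end
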